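(* $T_2(5)=9$; that is, every triangle-free graph on $9$ vertices contains a $2$-sparse set of $5$ vertices, and there is a triangle-free graph on $8$ vertices containing no $2$-sparse set of $5$ vertices.
   Context: All graphs are finite and simple. A set $S$ of vertices of a graph $G$ is $k$-sparse if the induced subgraph $G[S]$ has maximum degree at most $k$. For integers $k\ge0$ and $j\ge1$, $T_k(j)$ denotes the minimum $n$ such that every triangle-free graph on $n$ vertices contains a $k$-sparse set of $j$ vertices. *)

theory Defs
  imports "Graph_Theory.Graph_Theory"
begin

text \<open>
  A finite simple graph is a \<open>pair_graph\<close>: a finite vertex set with a symmetric, irreflexive arc
  relation, so every edge occurs as two opposite arcs and \<open>out_degree\<close> is the usual degree.
\<close>

definition triangle_free :: "'a pair_pre_digraph \<Rightarrow> bool" where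
  "triangle_free G \<longleftrightarrow>
     \<not> (\<exists>u v w. (u, v) \<in> parcs G \<and> (v, w) \<in> parcs G \<and> (w, u) \<in> parcs G)"

definition sparse_set :: "nat \<Rightarrow> 'a pair_pre_digraph \<Rightarrow> 'a set \<Rightarrow> bool" where
  "sparse_set k G S \<longleftrightarrow>
     S \<subseteq> pverts G \<and> (\<forall>v \<in> S. out_degree (with_proj G \<restriction> S) v \<le> k)"

text \<open>
  Every finite graph is isomorphic to one whose vertices are natural numbers, so nothing is lost
  by letting the minimum range over those.
\<close>

definition T :: "nat \<Rightarrow> nat \<Rightarrow> nat" where
  "T k j = (LEAST n. \<forall>G :: nat pair_pre_digraph.
     pair_graph G \<longrightarrow> triangle_free G \<longrightarrow> card (pverts G) = n \<longrightarrow>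
       (\<exists>S. sparse_set k G S \<and> card S = j))"

end

theory Submission
  imports Defs
begin

text \<open>
  Upper bound. If some vertex has four neighbours, they form an independent set \<open>I\<close>. Either a vertex
  outside \<open>I\<close> has at most two neighbours in \<open>I\<close> and can be added to it, or any two of the five
  outside vertices have a common neighbour in \<open>I\<close>, so that these five are independent.
  If all degrees are at most three, pick a vertex \<open>v\<close> and five vertices not adjacent to it. If these
  are not 2-sparse, they consist of some \<open>w\<close>, three of its neighbours \<open>x, y, z\<close>, and some \<open>u\<close>.
  Then \<open>{x, y, z, u, v}\<close> is 2-sparse unless \<open>u\<close> is adjacent to \<open>x, y, z\<close>, in which case
  \<open>u\<close>, \<open>w\<close> and the three vertices other than \<open>u, v, w, x, y, z\<close> form a 2-sparse set, because
  \<open>u\<close> and \<open>w\<close> are isolated in it.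
  Lower bound: the complete bipartite graph on two classes of four vertices and its subgraphs.
\<close>

definition nbrs :: "'a pair_pre_digraph \<Rightarrow> 'a \<Rightarrow> 'a set" where
  "nbrs G v = {u. (v, u) \<in> parcs G}"

text \<open>For \<open>v\<close> in \<open>S\<close>, the arcs leaving \<open>v\<close> in the
  induced subgraph are the pairs \<open>(v, u)\<close> with \<open>u\<close> in
  \<open>nbrs G v \<inter> S\<close>. All later sparsity checks become counts of such
  intersections.\<close>

lemma sparse_set_iff_card_nbrs:
  "sparse_set k G S \<longleftrightarrow> S \<subseteq> pverts G \<and> (\<forall>v\<in>S. card (nbrs G v \<inter> S) \<le> k)"
proof -
  have "out_degree (with_proj G \<restriction> S) v = card (nbrs G v \<inter> S)" if "v \<in> S" for v
  proof -
    have "out_arcs (with_proj G \<restriction> S) v = Pair v ` (nbrs G v \<inter> S)"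
      using that by (auto simp: out_arcs_def nbrs_def induce_subgraph_def)
    then show ?thesis
      by (simp add: out_degree_def card_image inj_on_def)
  qed
  then show ?thesis
    by (auto simp: sparse_set_def)
qed

context pair_graph
begin

lemma mem_nbrs_commute: "u \<in> nbrs G v \<longleftrightarrow> v \<in> nbrs G u"
  using arcs_symmetric by (auto simp: nbrs_def)

lemma not_mem_nbrs_self: "v \<notin> nbrs G v"
  using no_loops unfolding nbrs_def by fastforce

lemma nbrs_subset_verts: "nbrs G v \<subseteq> pverts G"
  by (auto simp: nbrs_def dest: wellformed)

lemma finite_nbrs: "finite (nbrs G v)"
  using nbrs_subset_verts finite_subset pair_finite_verts by blast

text \<open>A common neighbour of two adjacent vertices would close a triangle. Applied to a
  neighbour of \<open>v\<close>, this also shows that \<open>nbrs G v\<close> is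
  independent.\<close>

lemma triangle_free_nbrs_disjoint:
  assumes "triangle_free G" and "u \<in> nbrs G v"
  shows "nbrs G u \<inter> nbrs G v = {}"
  using assms arcs_symmetric unfolding triangle_free_def nbrs_def by blast

lemma sparse_set_of_degree_ge_4:
  assumes tf: "triangle_free G" and card9: "card (pverts G) = 9" and deg: "card (nbrs G v) \<ge> 4"
  shows "\<exists>S. sparse_set 2 G S \<and> card S = 5"
proof -
  obtain I where I: "I \<subseteq> nbrs G v" "card I = 4"
    using obtain_subset_with_card_n[OF deg] by blast
  have finI: "finite I" using I finite_nbrs finite_subset by blast
  have IV: "I \<subseteq> pverts G" using I nbrs_subset_verts by blast
  have indep: "nbrs G x \<inter> I = {}" if "x \<in> I" for x
    using triangle_free_nbrs_disjoint[OF tf, of x v] I that by blast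
  show ?thesis
  proof (cases "\<exists>w\<in>pverts G - I. card (nbrs G w \<inter> I) \<le> 2")
    case True
    then obtain w where w: "w \<in> pverts G" "w \<notin> I" "card (nbrs G w \<inter> I) \<le> 2" by blast
    have "card (nbrs G x \<inter> insert w I) \<le> 2" if "x \<in> insert w I" for x
    proof (cases "x = w")
      case True
      then have "nbrs G x \<inter> insert w I = nbrs G w \<inter> I" using not_mem_nbrs_self by blast
      then show ?thesis using w by simp
    next
      case False
      then have "nbrs G x \<inter> insert w I \<subseteq> {w}" using indep that by blast
      then have "card (nbrs G x \<inter> insert w I) \<le> card {w}" by (intro card_mono) auto
      then show ?thesis by simp
    qed
    then have "sparse_set 2 G (insert w I)" using w IV by (simp add: sparse_set_iff_card_nbrs)
    moreover have "card (insert w I) = 5" using w I finI by simp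
    ultimately show ?thesis by blast
  next
    case False
    let ?S = "pverts G - I"
    \<comment> \<open>Adjacent \<open>x\<close> and \<open>y\<close> outside \<open>I\<close> would
      have disjoint sets of at least three neighbours each inside the four-element set
      \<open>I\<close>.\<close>
    have "nbrs G x \<inter> ?S = {}" if x: "x \<in> ?S" for x
    proof (rule ccontr)
      assume "nbrs G x \<inter> ?S \<noteq> {}"
      then obtain y where y: "y \<in> ?S" "y \<in> nbrs G x" by blast
      have "(nbrs G y \<inter> I) \<inter> (nbrs G x \<inter> I) = {}"
        using triangle_free_nbrs_disjoint[OF tf y(2)] by blast
      then have "card (nbrs G y \<inter> I) + card (nbrs G x \<inter> I)
          = card ((nbrs G y \<inter> I) \<union> (nbrs G x \<inter> I))"
        using finI by (simp add: card_Un_disjoint)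
      also have "\<dots> \<le> card I" by (rule card_mono[OF finI]) auto
      finally have "card (nbrs G y \<inter> I) + card (nbrs G x \<inter> I) \<le> 4" using I by simp
      moreover have "card (nbrs G x \<inter> I) > 2" "card (nbrs G y \<inter> I) > 2"
        using False x y by (meson not_le)+
      ultimately show False by linarith
    qed
    then have "sparse_set 2 G ?S" by (simp add: sparse_set_iff_card_nbrs)
    moreover have "card ?S = 5" using card9 I IV finI by (simp add: card_Diff_subset)
    ultimately show ?thesis by blast
  qed
qed

lemma sparse_set_of_degrees_le_3:
  assumes tf: "triangle_free G" and card9: "card (pverts G) = 9"
    and deg: "\<And>v. card (nbrs G v) \<le> 3"
  shows "\<exists>S. sparse_set 2 G S \<and> card S = 5"
proof -
  have fin: "finite (pverts G)" by (rule pair_finite_verts)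
  obtain v where v: "v \<in> pverts G" using card9 by fastforce
  have "card (insert v (nbrs G v)) \<le> 4" using deg[of v] finite_nbrs not_mem_nbrs_self by simp
  then have "5 \<le> card (pverts G - insert v (nbrs G v))"
    using card9 diff_card_le_card_Diff[of "insert v (nbrs G v)" "pverts G"] finite_nbrs by simp
  then obtain W where W: "W \<subseteq> pverts G - insert v (nbrs G v)" "card W = 5"
    by (rule obtain_subset_with_card_n)
  have finW: "finite W" using W fin finite_subset by blast
  show ?thesis
  proof (cases "sparse_set 2 G W")
    case True
    then show ?thesis using W by blast
  next
    case False
    then obtain w where w: "w \<in> W" "card (nbrs G w \<inter> W) > 2"
      using W by (auto simp: sparse_set_iff_card_nbrs not_le)
    define X where "X = nbrs G w"
    \<comment> \<open>More than two neighbours of \<open>w\<close> lie in \<open>W\<close> and there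
      are at most three in all, so all three lie in \<open>W\<close>. One further vertex of
      \<open>W\<close> remains, namely \<open>u\<close>.\<close>
    have "card (X \<inter> W) \<le> card X" unfolding X_def by (intro card_mono finite_nbrs) auto
    then have X: "card X = 3" "X \<inter> W = X"
      using w deg[of w] card_subset_eq[OF finite_nbrs, of "X \<inter> W" w] by (auto simp: X_def)
    have finX: "finite X" by (simp add: X_def finite_nbrs)
    have wX: "w \<notin> X" by (simp add: X_def not_mem_nbrs_self)
    have "card (W - insert w X) = 1"
      using X w wX W finX by (subst card_Diff_subset) auto
    then obtain u where u: "W - insert w X = {u}" by (auto simp: card_1_singleton_iff)
    have vW: "v \<notin> W" "nbrs G v \<inter> W = {}" using W by auto
    have indep: "nbrs G x \<inter> X = {}" if "x \<in> X" for x
      using triangle_free_nbrs_disjoint[OF tf, of x w] that unfolding X_def by blast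
    have uv: "u \<in> W" "u \<notin> X" "u \<noteq> w" "u \<noteq> v" "v \<notin> X" "v \<noteq> w" using u vW X w by auto
    show ?thesis
    proof (cases "X \<subseteq> nbrs G u")
      case False
      let ?S = "insert u (insert v X)"
      have v_isolated: "v \<notin> nbrs G x" if "x \<in> W" for x
        using vW that mem_nbrs_commute by blast
      have "card (nbrs G x \<inter> ?S) \<le> 2" if x: "x \<in> ?S" for x
      proof -
        consider "x = v" | "x = u" | "x \<in> X" using x by blast
        then show ?thesis
        proof cases
          case 1
          then have "nbrs G x \<inter> ?S = {}" using vW X uv not_mem_nbrs_self by blast
          then show ?thesis by simp
        next
          case 2
          \<comment> \<open>Neither \<open>u\<close> nor \<open>v\<close> is a neighbour of
            \<open>u\<close>, and some element of \<open>X\<close> is not one either, which leaves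
            at most two.\<close>
          then have "nbrs G x \<inter> ?S \<subset> X"
            using False v_isolated[OF uv(1)] not_mem_nbrs_self by blast
          then have "card (nbrs G x \<inter> ?S) < card X" by (rule psubset_card_mono[OF finX])
          then show ?thesis using X by simp
        next
          case 3
          then have "nbrs G x \<inter> ?S \<subseteq> {u}" using indep v_isolated X by blast
          then have "card (nbrs G x \<inter> ?S) \<le> card {u}" by (intro card_mono) auto
          then show ?thesis by simp
        qed
      qed
      moreover have "?S \<subseteq> pverts G" using v W u X by blast
      ultimately have "sparse_set 2 G ?S" by (simp add: sparse_set_iff_card_nbrs)
      moreover have "card ?S = 5" using uv X finX by simp
      ultimately show ?thesis by blast
    next
      case True
      \<comment> \<open>The three vertices of \<open>X\<close> already exhaust the degree bound at
        \<open>u\<close>, so \<open>u\<close> and \<open>w\<close> have the same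
        neighbourhood.\<close>
      then have nu: "nbrs G u = X" using deg[of u] X card_seteq[OF finite_nbrs] by metis
      define R where "R = pverts G - insert v (insert u (insert w X))"
      have sub: "insert v (insert u (insert w X)) \<subseteq> pverts G" using v W w u X by blast
      have finR: "finite R" by (simp add: R_def fin)
      have cardR: "card R = 3"
        unfolding R_def using sub fin finX card9 X uv wX by (subst card_Diff_subset) auto
      let ?S = "insert u (insert w R)"
      have "card (nbrs G x \<inter> ?S) \<le> 2" if "x \<in> ?S" for x
      proof (cases "x \<in> R")
        case True
        then have "x \<notin> X" by (simp add: R_def)
        then have "u \<notin> nbrs G x" "w \<notin> nbrs G x"
          using nu mem_nbrs_commute by (auto simp: X_def)
        \<comment> \<open>The inclusion is strict because \<open>x\<close> itself lies in
          \<open>R\<close>; since \<open>R\<close> has three elements, at most two neighbours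
          remain.\<close>
        then have "nbrs G x \<inter> ?S \<subset> R" using True not_mem_nbrs_self by blast
        then have "card (nbrs G x \<inter> ?S) < card R" by (rule psubset_card_mono[OF finR])
        then show ?thesis using cardR by simp
      next
        case False
        then have "nbrs G x = X" using that nu by (auto simp: X_def)
        then have "nbrs G x \<inter> ?S = {}" using uv wX by (auto simp: R_def)
        then show ?thesis by simp
      qed
      moreover have "?S \<subseteq> pverts G" using sub by (auto simp: R_def)
      ultimately have "sparse_set 2 G ?S" by (simp add: sparse_set_iff_card_nbrs)
      moreover have "card ?S = 5" using uv finR cardR by (simp add: R_def)
      ultimately show ?thesis by blast
    qed
  qed
qed

lemma nine_vertices_sparse_set:
  assumes "triangle_free G" and "card (pverts G) = 9"
  shows "\<exists>S. sparse_set 2 G S \<and> card S = 5"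
proof (cases "\<exists>v. card (nbrs G v) \<ge> 4")
  case True
  then show ?thesis using assms sparse_set_of_degree_ge_4 by blast
next
  case False
  then have "card (nbrs G v) < 4" for v
    by (simp add: not_le)
  then have "card (nbrs G v) \<le> 3" for v
    by (simp add: less_Suc_eq_le[symmetric])
  then show ?thesis using assms sparse_set_of_degrees_le_3 by blast
qed

end

text \<open>The balanced complete bipartite graph on \<open>n\<close> vertices, with the parity
  classes as its sides; \<open>n = 8\<close> gives four vertices on each side.\<close>

definition parity_graph :: "nat \<Rightarrow> nat pair_pre_digraph" where
  "parity_graph n = \<lparr>pverts = {..<n}, parcs = {(i, j). i < n \<and> j < n \<and> even i \<noteq> even j}\<rparr>"

lemma pair_graph_parity_graph: "pair_graph (parity_graph n)"
proof
  show "finite (parcs (parity_graph n))"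
    by (rule finite_subset[of _ "{..<n} \<times> {..<n}"]) (auto simp: parity_graph_def)
  show "symmetric (parity_graph n)"
    unfolding symmetric_def by (rule symI) (auto simp: parity_graph_def)
qed (auto simp: parity_graph_def)

lemma triangle_free_parity_graph: "triangle_free (parity_graph n)"
  by (auto simp: triangle_free_def parity_graph_def)

lemma card_verts_parity_graph: "card (pverts (parity_graph n)) = n"
  by (simp add: parity_graph_def)

text \<open>Each side has at most \<open>2 * k\<close> vertices, so a set of
  \<open>2 * k + 1\<close> vertices meets both. A chosen vertex on one side is adjacent to all
  chosen vertices on the other, so sparsity would allow at most \<open>k\<close> on each side, hence
  \<open>2 * k\<close> in total.\<close>

lemma parity_graph_no_sparse_set:
  assumes n: "n \<le> 4 * k"
  shows "\<not> (\<exists>S. sparse_set k (parity_graph n) S \<and> card S = 2 * k + 1)"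
proof
  assume "\<exists>S. sparse_set k (parity_graph n) S \<and> card S = 2 * k + 1"
  then obtain S where S: "S \<subseteq> {..<n}" "card S = 2 * k + 1"
    and deg: "\<And>v. v \<in> S \<Longrightarrow> card (nbrs (parity_graph n) v \<inter> S) \<le> k"
    by (auto simp: sparse_set_iff_card_nbrs parity_graph_def)
  define A where "A = {i \<in> S. even i}"
  define B where "B = {i \<in> S. odd i}"
  have finS: "finite S" using S finite_subset by blast
  have "S = A \<union> B" "A \<inter> B = {}" by (auto simp: A_def B_def)
  then have sum: "card A + card B = 2 * k + 1"
    using S finS by (metis card_Un_disjoint finite_Un)
  have "A \<subseteq> (\<lambda>i. 2 * i) ` {..<2 * k}" using S n by (auto simp: A_def elim!: evenE)
  then have "card A \<le> 2 * k" using surj_card_le[of "{..<2 * k}" A] by simp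
  with sum obtain b where b: "b \<in> B" by fastforce
  have "B \<subseteq> (\<lambda>i. 2 * i + 1) ` {..<2 * k}" using S n by (auto simp: B_def elim!: oddE)
  then have "card B \<le> 2 * k" using surj_card_le[of "{..<2 * k}" B] by simp
  with sum obtain a where a: "a \<in> A" by fastforce
  have "nbrs (parity_graph n) a \<inter> S = B" "nbrs (parity_graph n) b \<inter> S = A"
    using a b S by (auto simp: nbrs_def parity_graph_def A_def B_def)
  with deg[of a] deg[of b] a b have "card A \<le> k" "card B \<le> k" by (auto simp: A_def B_def)
  with sum show False by simp
qed

theorem theorem3p4:
  shows "T 2 5 = 9 \<and>
    (\<forall>G :: 'a pair_pre_digraph.
       pair_graph G \<longrightarrow> triangle_free G \<longrightarrow> card (pverts G) = 9 \<longrightarrow>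
         (\<exists>S. sparse_set 2 G S \<and> card S = 5)) \<and>
    (\<exists>G :: nat pair_pre_digraph.
       pair_graph G \<and> triangle_free G \<and> card (pverts G) = 8 \<and>
         \<not> (\<exists>S. sparse_set 2 G S \<and> card S = 5))"
proof (intro conjI)
  \<comment> \<open>Minimality of 9 is checked by a counterexample for every
    \<open>n \<le> 8\<close>, which avoids showing that the property defining \<open>T\<close> is
    monotone in \<open>n\<close>.\<close>
  have lower: "\<not> (\<exists>S. sparse_set 2 (parity_graph n) S \<and> card S = 5)" if "n \<le> 8" for n
    using parity_graph_no_sparse_set[of n 2] that by simp
  show "T 2 5 = 9"
    unfolding T_def
  proof (rule Least_equality)
    fix n
    assume "\<forall>G :: nat pair_pre_digraph.
      pair_graph G \<longrightarrow> triangle_free G \<longrightarrow> card (pverts G) = n \<longrightarrow>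
        (\<exists>S. sparse_set 2 G S \<and> card S = 5)"
    then have "\<not> n \<le> 8"
      using lower pair_graph_parity_graph triangle_free_parity_graph card_verts_parity_graph
      by blast
    then show "9 \<le> n" by simp
  qed (use pair_graph.nine_vertices_sparse_set in blast)
  show "\<forall>G :: 'a pair_pre_digraph.
      pair_graph G \<longrightarrow> triangle_free G \<longrightarrow> card (pverts G) = 9 \<longrightarrow>
        (\<exists>S. sparse_set 2 G S \<and> card S = 5)"
    using pair_graph.nine_vertices_sparse_set by blast
  show "\<exists>G :: nat pair_pre_digraph.
      pair_graph G \<and> triangle_free G \<and> card (pverts G) = 8 \<and>
        \<not> (\<exists>S. sparse_set 2 G S \<and> card S = 5)"
    using lower[of 8] pair_graph_parity_graph triangle_free_parity_graph card_verts_parity_graph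
    by blast
qed

end
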